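(* Let $\theta\in[0,1)$ and let $u^0\in V$ be a deterministic initial guess. Consider the fault-tolerant randomized successive subspace correction method: at each iteration $k\ge0$, with probability $\theta$ an error occurs and then $u^{k+1}=u^k$; otherwise (with probability $1-\theta$) an index $i\in\{1,\dots,J\}$ is drawn uniformly (probability $\frac1J$) and $$u^{k+1}=u^k+R_iQ_i(f-Au^k).$$ Assume that the probability $\theta$ of an error is independent of $k$, and that the occurrence of errors is independent of how $i$ is picked (and the draws at different iterations are independent). Assume that $\|I-T_i\|_A<1$ for $i=1,2,\dots,J$. Then the method converges almost surely (with probability $1$): with $e^k=u-u^k$, where $u$ is the solution of $Au=f$, $$\|e^k\|_A^2\longrightarrow 0\quad\text{almost surely as } k\to\infty .$$
   Context: $V$ is a Hilbert space with inner product $(\cdot,\cdot)$, $A:V\to V$ is a symmetric positive definite linear operator, $(v,w)_A=(Av,w)$ and $\|v\|_A^2=(v,v)_A$. Given $f\in V$, $u\in V$ denotes the solution of $Au=f$. The space is decomposed as $V=\sum_{i=1}^J V_i$ with subspaces $V_i\subset V$ (the sum need not be direct). For each $i$, the operators $Q_i,P_i:V\to V_i$ and $A_i:V_i\to V_i$ are defined by $(Q_iv,v_i)=(v,v_i)$, $(P_iv,v_i)_A=(v,v_i)_A$ for all $v\in V$, $v_i\in V_i$, and $(A_iw_i,v_i)=(Aw_i,v_i)$ for all $w_i,v_i\in V_i$. $R_i:V_i\to V_i$ is a given nonsingular linear operator (an approximation of $A_i^{-1}$). Define $T_i=R_iQ_iA=R_iA_iP_i$. The condition $\|I-T_i\|_A<1$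 refers to $T_i$ as an operator $V_i\to V_i$, i.e. the operator norm induced by $\|\cdot\|_A$ on $V_i$. *)

theory Defs
  imports "HOL-Probability.Probability"
begin

definition spd :: "('v::real_inner \<Rightarrow> 'v) \<Rightarrow> bool" where
  "spd A \<longleftrightarrow> linear A \<and> (\<forall>v w. inner (A v) w = inner v (A w)) \<and>
     (\<forall>v. v \<noteq> 0 \<longrightarrow> inner (A v) v > 0)"

definition A_norm :: "('v::real_inner \<Rightarrow> 'v) \<Rightarrow> 'v \<Rightarrow> real" where
  "A_norm A v = sqrt (inner (A v) v)"

(* Extended reals, so that an operator unbounded on W has norm infinity
   (a real-valued Sup would be unspecified there).  The vector 0 contributes 0 / 0 = 0. *)
definition A_onorm_on :: "('v::real_inner \<Rightarrow> 'v) \<Rightarrow> 'v set \<Rightarrow> ('v \<Rightarrow> 'v) \<Rightarrow> ereal" where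
  "A_onorm_on A W S = (SUP v\<in>W. ereal (A_norm A (S v) / A_norm A v))"

definition nonsingular_on :: "'v::real_vector set \<Rightarrow> ('v \<Rightarrow> 'v) \<Rightarrow> bool" where
  "nonsingular_on W S \<longleftrightarrow>
     (\<forall>v\<in>W. \<forall>w\<in>W. S (v + w) = S v + S w) \<and>
     (\<forall>c. \<forall>v\<in>W. S (c *\<^sub>R v) = c *\<^sub>R S v) \<and>
     bij_betw S W W"

(* Asserting this of Q includes the existence of the projection, hence closedness of W. *)
definition is_orth_proj :: "'v::real_inner set \<Rightarrow> ('v \<Rightarrow> 'v) \<Rightarrow> bool" where
  "is_orth_proj W Q \<longleftrightarrow> (\<forall>v. Q v \<in> W \<and> (\<forall>w\<in>W. inner (Q v) w = inner v w))"

definition T_op :: "('v \<Rightarrow> 'v) \<Rightarrow> (nat \<Rightarrow> 'v \<Rightarrow> 'v) \<Rightarrow> (nat \<Rightarrow> 'v \<Rightarrow> 'v) \<Rightarrow> nat \<Rightarrow> 'v \<Rightarrow> 'v" where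
  "T_op A Q R i v = R i (Q i (A v))"

(* One trajectory: err k says whether an error occurs in step k, idx k is the index drawn in
   step k.  An index is drawn in every step but ignored when an error occurs. *)
primrec ft_iterate ::
  "('v::real_vector \<Rightarrow> 'v) \<Rightarrow> (nat \<Rightarrow> 'v \<Rightarrow> 'v) \<Rightarrow> (nat \<Rightarrow> 'v \<Rightarrow> 'v) \<Rightarrow> 'v \<Rightarrow> 'v \<Rightarrow>
   (nat \<Rightarrow> bool) \<Rightarrow> (nat \<Rightarrow> nat) \<Rightarrow> nat \<Rightarrow> 'v" where
  "ft_iterate A Q R f u0 err idx 0 = u0"
| "ft_iterate A Q R f u0 err idx (Suc k) =
     (let uk = ft_iterate A Q R f u0 err idx k
      in if err k then uk else uk + R (idx k) (Q (idx k) (f - A uk)))"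

(* The product law of a single step makes err k Bernoulli with parameter theta, idx k uniform
   on {1..J}, and the two independent; the steps are mutually independent. *)
definition ft_sampling ::
  "'w measure \<Rightarrow> real \<Rightarrow> nat \<Rightarrow> (nat \<Rightarrow> 'w \<Rightarrow> bool) \<Rightarrow> (nat \<Rightarrow> 'w \<Rightarrow> nat) \<Rightarrow> bool" where
  "ft_sampling M \<theta> J err idx \<longleftrightarrow>
     prob_space M \<and>
     prob_space.indep_vars M (\<lambda>_. count_space UNIV) (\<lambda>k \<omega>. (err k \<omega>, idx k \<omega>)) UNIV \<and>
     (\<forall>k. distr M (count_space UNIV) (\<lambda>\<omega>. (err k \<omega>, idx k \<omega>)) =
          measure_pmf (pair_pmf (bernoulli_pmf \<theta>) (pmf_of_set {1..J})))"

end

theory Submission imports Defs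
begin

text \<open>Uniform boundedness shows that \<open>\<parallel>\<cdot>\<parallel>\<^sub>A\<close> is equivalent to the norm of the space and that the energies
  of the projections \<open>P i e\<close> control the energy of \<open>e\<close>: some \<open>c > 0\<close> satisfies
  \<open>c * \<parallel>e\<parallel>\<^sub>A\<^sup>2 \<le> (\<Sum>i. \<parallel>P i e\<parallel>\<^sub>A\<^sup>2)\<close>. Since \<open>T i e = T i (P i e)\<close> and \<open>I - T i\<close> is a contraction on
  \<open>V i\<close>, one correction lowers the squared energy norm of the error by at least a multiple of
  \<open>\<parallel>P i e\<parallel>\<^sub>A\<^sup>2\<close>. A random correction therefore shrinks the expected energy by a fixed factor, the
  expected energies are summable, and by monotone convergence so are the energies along almost
  every trajectory.\<close>

section \<open>Uniform boundedness\<close>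

text \<open>By Baire, one of the closed sets \<open>F n\<close> contains a ball, and displacing its
  centre along \<open>y i\<close> bounds the norm of \<open>y i\<close>. Carrying the weight
  \<open>p i\<close> along instead of dividing by it also covers \<open>p i = 0\<close>, where the
  bound forces \<open>y i = 0\<close>.\<close>

lemma norm_bound_of_pointwise_bound:
  fixes y :: "'i \<Rightarrow> 'v::{real_inner,complete_space}"
  assumes p: "\<And>i. 0 \<le> p i"
    and bdd: "\<And>v. \<exists>c. \<forall>i. \<bar>inner (y i) v\<bar> \<le> c * p i"
  shows "\<exists>C\<ge>0. \<forall>i. norm (y i) \<le> C * p i"
proof -
  define F where "F n = {v. \<forall>i. \<bar>inner (y i) v\<bar> \<le> real n * p i}" for n
  have closed: "closed (F n)" for n
    unfolding F_def by (intro closed_Collect_all closed_Collect_le continuous_intros)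
  have "\<exists>n. v \<in> F n" for v
  proof -
    obtain c where c: "\<forall>i. \<bar>inner (y i) v\<bar> \<le> c * p i"
      using bdd by blast
    obtain n where "c \<le> real n"
      using real_arch_simple by blast
    then have "v \<in> F n"
      unfolding F_def using c p by (auto intro: order_trans[OF _ mult_right_mono])
    then show ?thesis ..
  qed
  then have cover: "(\<Union>n. F n) = UNIV"
    by blast
  have "\<exists>n. interior (F n) \<noteq> {}"
  proof (rule ccontr)
    assume "\<not> ?thesis"
    then have "Met_TC.mtopology interior_of \<Union>(range F) = {}"
      using closed by (intro Met_TC.metric_Baire_category_alt) (auto simp: complete_UNIV)
    then show False
      by (simp add: cover)
  qed
  then obtain n x where "x \<in> interior (F n)"
    by blast
  then obtain e where e: "e > 0" "cball x e \<subseteq> F n"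
    by (meson interior_subset open_contains_cball open_interior subset_trans)
  have "norm (y i) \<le> 2 * real n / e * p i" for i
  proof (cases "y i = 0")
    case False
    \<comment> \<open>Moves the centre by length \<open>e\<close> along \<open>y i\<close>. The two
      inner products differ by \<open>e * norm (y i)\<close>, and each is at most
      \<open>n * p i\<close> in absolute value, whence the factor 2.\<close>
    define z where "z = x + (e / norm (y i)) *\<^sub>R y i"
    have "z \<in> cball x e" "x \<in> cball x e"
      using False e by (auto simp: z_def dist_norm)
    then have "\<bar>inner (y i) z\<bar> \<le> real n * p i" "\<bar>inner (y i) x\<bar> \<le> real n * p i"
      using e unfolding F_def by blast+
    moreover have "inner (y i) z - inner (y i) x = e * norm (y i)"
      by (simp add: z_def inner_add_right dot_square_norm power2_eq_square)
    ultimately have "e * norm (y i) \<le> 2 * (real n * p i)"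
      by linarith
    then show ?thesis
      using e by (simp add: field_simps)
  qed (use p e in auto)
  then show ?thesis
    using e by (intro exI[of _ "2 * real n / e"]) auto
qed

section \<open>The energy norm and its equivalence to the norm\<close>

lemma spd_linear: "spd A \<Longrightarrow> linear A"
  and spd_sym: "spd A \<Longrightarrow> inner (A v) w = inner v (A w)"
  by (auto simp: spd_def)

lemma spd_pos: "spd A \<Longrightarrow> v \<noteq> 0 \<Longrightarrow> 0 < inner (A v) v"
  unfolding spd_def by blast

lemma spd_nonneg: "spd A \<Longrightarrow> 0 \<le> inner (A v) v"
  using spd_pos[of A v] by (cases "v = 0") (auto intro: less_imp_le)

lemma A_norm_sq: "spd A \<Longrightarrow> (A_norm A v)\<^sup>2 = inner (A v) v"
  by (simp add: A_norm_def spd_nonneg)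

lemma A_norm_nonneg: "spd A \<Longrightarrow> 0 \<le> A_norm A v"
  by (simp add: A_norm_def spd_nonneg)

lemma A_norm_sq_add:
  assumes "spd A"
  shows "(A_norm A (v + w))\<^sup>2 = (A_norm A v)\<^sup>2 + 2 * inner (A v) w + (A_norm A w)\<^sup>2"
  using assms spd_sym[OF assms, of w v]
  by (simp add: A_norm_sq linear_add[OF spd_linear] inner_add_left inner_add_right inner_commute)

lemma A_norm_Cauchy_Schwarz:
  assumes A: "spd A"
  shows "\<bar>inner (A v) w\<bar> \<le> A_norm A v * A_norm A w"
proof (cases "w = 0")
  case False
  then have w: "inner (A w) w > 0"
    using A by (rule spd_pos[rotated])
  \<comment> \<open>The minimiser of the quadratic
    \<open>inner (A (v + t *\<^sub>R w)) (v + t *\<^sub>R w)\<close> in \<open>t\<close>;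
    nonnegativity of the minimum is the claim.\<close>
  define t where "t = - inner (A v) w / inner (A w) w"
  have "0 \<le> inner (A (v + t *\<^sub>R w)) (v + t *\<^sub>R w)"
    using A by (rule spd_nonneg)
  also have "\<dots> = inner (A v) v + 2 * t * inner (A v) w + t\<^sup>2 * inner (A w) w"
    using spd_sym[OF A, of w v]
    by (simp add: linear_add[OF spd_linear[OF A]] linear_cmul[OF spd_linear[OF A]]
        inner_add_left inner_add_right inner_commute power2_eq_square algebra_simps)
  also have "\<dots> = inner (A v) v - (inner (A v) w)\<^sup>2 / inner (A w) w"
    using w by (simp add: t_def field_simps power2_eq_square)
  finally have "(inner (A v) w)\<^sup>2 \<le> (A_norm A v * A_norm A w)\<^sup>2"
    using w A by (simp add: power_mult_distrib A_norm_sq field_simps)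
  then show ?thesis
    using A by (metis A_norm_nonneg abs_of_nonneg mult_nonneg_nonneg real_sqrt_abs
        real_sqrt_le_mono)
qed (use assms in \<open>simp add: A_norm_def\<close>)

text \<open>Everywhere defined and symmetric implies bounded (Hellinger--Toeplitz), and surjectivity
  makes \<^term>\<open>A\<close> coercive.\<close>

lemma A_norm_equiv:
  fixes A :: "'v::{real_inner,complete_space} \<Rightarrow> 'v"
  assumes A: "spd A" and surj: "surj A"
  shows "\<exists>c>0. \<forall>v. norm v \<le> c * A_norm A v \<and> A_norm A v \<le> c * norm v"
proof -
  \<comment> \<open>Symmetry moves \<open>A\<close> onto the fixed \<open>w\<close>, so the family
    \<open>A v\<close> is weakly bounded relative to \<open>norm v\<close>.\<close>
  have "\<exists>c. \<forall>v. \<bar>inner (A v) w\<bar> \<le> c * norm v" for w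
    by (rule exI[of _ "norm (A w)"])
      (metis A Cauchy_Schwarz_ineq2 mult.commute spd_sym)
  then obtain a where a: "a \<ge> 0" "\<And>v. norm (A v) \<le> a * norm v"
    using norm_bound_of_pointwise_bound[of norm A] by auto
  \<comment> \<open>Writing \<open>w = A z\<close> turns \<open>inner v w\<close> into an energy
    product, so the vectors \<open>v\<close> are weakly bounded relative to
    \<open>A_norm A v\<close>.\<close>
  have "\<exists>c. \<forall>v. \<bar>inner v w\<bar> \<le> c * A_norm A v" for w
  proof -
    obtain z where "w = A z"
      using surj by (metis surjD)
    then show ?thesis
      using A_norm_Cauchy_Schwarz[OF A, of _ z] spd_sym[OF A]
      by (intro exI[of _ "A_norm A z"]) (simp add: mult.commute)
  qed
  then obtain b where b: "b \<ge> 0" "\<And>v. norm v \<le> b * A_norm A v"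
    using norm_bound_of_pointwise_bound[of "A_norm A" "\<lambda>v. v"] A_norm_nonneg[OF A] by auto
  define c where "c = 1 + b + sqrt a"
  have "A_norm A v \<le> sqrt a * norm v" for v
  proof -
    have "inner (A v) v \<le> norm (A v) * norm v"
      by (rule norm_cauchy_schwarz)
    also have "\<dots> \<le> a * norm v * norm v"
      by (intro mult_right_mono a) auto
    finally have "A_norm A v \<le> sqrt (a * norm v * norm v)"
      unfolding A_norm_def by (rule real_sqrt_le_mono)
    then show ?thesis
      by (simp add: real_sqrt_mult mult.assoc)
  qed
  then have "A_norm A v \<le> c * norm v" for v
    by (rule order_trans) (use a b in \<open>auto simp: c_def intro: mult_right_mono\<close>)
  moreover have "norm v \<le> c * A_norm A v" for v
    by (rule order_trans[OF b(2)]) (use a b A_norm_nonneg[OF A] in \<open>auto simp: c_def intro: mult_right_mono\<close>)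
  moreover have "c > 0"
    using a b by (simp add: c_def add_pos_nonneg)
  ultimately show ?thesis
    by blast
qed

section \<open>Correction on a single subspace\<close>

text \<open>For a limit \<open>l\<close> of points of \<open>W\<close>, the residual
  \<open>l - Q l\<close> is orthogonal to \<open>W\<close> and, in the limit, to itself. Closedness
  keeps the sum of the Neumann series inside \<open>W\<close>.\<close>

lemma closed_of_orth_proj:
  assumes W: "subspace W" and Q: "is_orth_proj W Q"
  shows "closed W"
proof (rule closed_sequential_limits[THEN iffD2], intro allI impI, elim conjE)
  fix x l assume x: "\<forall>n. x n \<in> W" and lim: "x \<longlonglongrightarrow> l"
  have Qd: "Q l \<in> W" "\<And>w. w \<in> W \<Longrightarrow> inner (l - Q l) w = 0"
    using Q by (auto simp: is_orth_proj_def inner_diff_left)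
  have "(\<lambda>n. inner (l - Q l) (x n - Q l)) \<longlonglongrightarrow> inner (l - Q l) (l - Q l)"
    by (intro tendsto_intros lim)
  moreover have "inner (l - Q l) (x n - Q l) = 0" for n
    using Qd x W by (simp add: subspace_diff)
  ultimately have "inner (l - Q l) (l - Q l) = 0"
    using LIMSEQ_unique tendsto_const by (metis (no_types, lifting) ext)
  then show "l \<in> W"
    using Qd by simp
qed

text \<open>An extended real below 1 and at least the quotient \<open>0 / 0 = 0\<close> is a genuine
  contraction factor. At \<open>v = 0\<close> the quotient carries no information, so
  \<open>S 0 = 0\<close> settles that case.\<close>

lemma A_onorm_on_less_1D:
  assumes A: "spd A" and W: "0 \<in> W" and S: "S 0 = 0" and lt: "A_onorm_on A W S < 1"
  shows "\<exists>\<rho>. 0 \<le> \<rho> \<and> \<rho> < 1 \<and> (\<forall>v\<in>W. A_norm A (S v) \<le> \<rho> * A_norm A v)"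
proof -
  have le: "ereal (A_norm A (S v) / A_norm A v) \<le> A_onorm_on A W S" if "v \<in> W" for v
    unfolding A_onorm_on_def using that by (rule SUP_upper)
  have "A_norm A 0 = 0"
    by (simp add: A_norm_def)
  then have "0 \<le> A_onorm_on A W S"
    using le[OF W] by (simp add: zero_ereal_def)
  then obtain \<rho> where \<rho>: "A_onorm_on A W S = ereal \<rho>" "0 \<le> \<rho>" "\<rho> < 1"
    using lt by (cases "A_onorm_on A W S") auto
  moreover have "A_norm A (S v) \<le> \<rho> * A_norm A v" if "v \<in> W" for v
  proof (cases "v = 0")
    case False
    then have "A_norm A v > 0"
      using A by (simp add: A_norm_def spd_pos)
    then show ?thesis
      using le[OF that] \<rho> by (simp add: divide_le_eq)
  qed (simp add: S \<open>A_norm A 0 = 0\<close>)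
  ultimately show ?thesis
    by blast
qed

text \<open>The solution is the series of the iterates of \<open>S\<close> on \<open>r\<close>. With
  \<open>S = I - T\<close> the equation reads \<open>T p = r\<close>, so \<open>T\<close> maps
  \<open>W\<close> onto \<open>W\<close>.\<close>

lemma Neumann_solution:
  fixes A :: "'v::{real_inner,complete_space} \<Rightarrow> 'v"
  assumes A: "spd A" "surj A"
    and W: "subspace W" "closed W"
    and S: "\<And>v. v \<in> W \<Longrightarrow> S v \<in> W"
      "\<And>v w. v \<in> W \<Longrightarrow> w \<in> W \<Longrightarrow> S (v + w) = S v + S w"
      "\<And>v. v \<in> W \<Longrightarrow> A_norm A (S v) \<le> \<rho> * A_norm A v"
    and \<rho>: "0 \<le> \<rho>" "\<rho> < 1" and r: "r \<in> W"
  shows "\<exists>p\<in>W. p - S p = r"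
proof -
  \<comment> \<open>\<open>S\<close> contracts in the energy norm, whereas completeness is available
    in the norm of the space; \<open>c\<close> converts between them.\<close>
  obtain c where c: "c > 0" "\<And>v. norm v \<le> c * A_norm A v" "\<And>v. A_norm A v \<le> c * norm v"
    using A_norm_equiv[OF A] by blast
  define t where "t k = (S ^^ k) r" for k
  have tW: "t k \<in> W" for k
    by (induction k) (auto simp: t_def r S)
  have "A_norm A (t k) \<le> \<rho> ^ k * A_norm A r" for k
  proof (induction k)
    case (Suc k)
    have "A_norm A (t (Suc k)) \<le> \<rho> * A_norm A (t k)"
      using S(3)[OF tW] by (simp add: t_def)
    also have "\<dots> \<le> \<rho> * (\<rho> ^ k * A_norm A r)"
      by (intro mult_left_mono Suc \<rho>)
    finally show ?case
      by (simp add: mult.assoc)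
  qed (simp add: t_def)
  then have t_le: "norm (t k) \<le> c * (\<rho> ^ k * A_norm A r)" for k
    using c(1) by (intro order_trans[OF c(2)] mult_left_mono) auto
  have "summable (\<lambda>k. c * (\<rho> ^ k * A_norm A r))"
    by (rule summable_mult[OF summable_mult2[OF summable_geometric]]) (use \<rho> in simp)
  then have "summable (\<lambda>k. norm (t k))"
    by (rule summable_comparison_test'[where N = 0]) (simp add: t_le)
  define p where "p n = (\<Sum>k<n. t k)" for n
  have "Cauchy p"
    unfolding Cauchy_altdef
  proof (intro allI impI)
    fix e :: real assume "e > 0"
    then obtain N where N: "\<And>m n. m \<ge> N \<Longrightarrow> norm (\<Sum>k=m..<n. norm (t k)) < e"
      using \<open>summable (\<lambda>k. norm (t k))\<close> unfolding summable_Cauchy by blast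
    have "dist (p m) (p n) < e" if "m \<ge> N" "n > m" for m n
    proof -
      have "p n - p m = (\<Sum>k=m..<n. t k)"
        using that sum_diff_nat_ivl[of 0 m n t] by (simp add: p_def lessThan_atLeast0)
      then have "dist (p m) (p n) = norm (\<Sum>k=m..<n. t k)"
        by (metis dist_commute dist_norm)
      also have "\<dots> \<le> (\<Sum>k=m..<n. norm (t k))"
        by (rule norm_sum)
      also have "\<dots> < e"
        using N[OF that(1), of n] by simp
      finally show ?thesis .
    qed
    then show "\<exists>M. \<forall>m\<ge>M. \<forall>n>m. dist (p m) (p n) < e"
      by blast
  qed
  then obtain q where q: "p \<longlonglongrightarrow> q"
    using Cauchy_convergent_iff convergent_def by blast
  have pW: "p n \<in> W" for n
    unfolding p_def using tW W by (intro subspace_sum) auto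
  then have qW: "q \<in> W"
    using q W(2) closed_sequentially by blast
  have S0: "S 0 = 0"
    using S(2)[of 0 0] W(1) subspace_0 by auto
  have Sp: "S (p n) = p (Suc n) - r" for n
  proof (induction n)
    case (Suc n)
    have "S (p (Suc n)) = S (p n) + S (t n)"
      using S(2)[OF pW tW] by (simp add: p_def)
    then show ?case
      using Suc by (simp add: p_def t_def)
  qed (simp add: p_def t_def S0)
  \<comment> \<open>Continuity of \<open>S\<close> on \<open>W\<close> follows from additivity and
    the contraction bound, at the price of two changes of norm. By \<open>Sp\<close> the same
    sequence tends to \<open>q - r\<close>.\<close>
  have "(\<lambda>n. S (p n)) \<longlonglongrightarrow> S q"
  proof (rule Lim_null_comparison[THEN Lim_null[THEN iffD2]])
    have "norm (S (p n) - S q) \<le> c * (\<rho> * (c * norm (p n - q)))" for n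
    proof -
      have d: "p n - q \<in> W"
        using pW qW W(1) by (simp add: subspace_diff)
      then have "norm (S (p n) - S q) = norm (S (p n - q))"
        using S(2)[OF _ qW, of "p n - q"] by simp
      also have "\<dots> \<le> c * A_norm A (S (p n - q))"
        by (rule c)
      also have "\<dots> \<le> c * (\<rho> * A_norm A (p n - q))"
        using c(1) by (intro mult_left_mono S d) auto
      also have "\<dots> \<le> c * (\<rho> * (c * norm (p n - q)))"
        using c(1) \<rho> by (intro mult_left_mono c) auto
      finally show ?thesis .
    qed
    then show "\<forall>\<^sub>F n in sequentially. norm (S (p n) - S q) \<le> c * (\<rho> * (c * norm (p n - q)))"
      by simp
    have "(\<lambda>n. c * (\<rho> * (c * norm (p n - q)))) \<longlonglongrightarrow> c * (\<rho> * (c * norm (q - q)))"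
      by (intro tendsto_intros q)
    then show "(\<lambda>n. c * (\<rho> * (c * norm (p n - q)))) \<longlonglongrightarrow> 0"
      by simp
  qed
  moreover have "(\<lambda>n. S (p n)) \<longlonglongrightarrow> q - r"
    unfolding Sp by (intro tendsto_intros LIMSEQ_Suc q)
  ultimately have "S q = q - r"
    by (rule LIMSEQ_unique)
  then show ?thesis
    using qW by (intro bexI[of _ q]) auto
qed

text \<open>Conditions on a single subspace \<open>W = V i\<close>, with \<open>Q = Q i\<close>, \<open>R = R i\<close>, \<open>T = T i\<close>; the
  vector \<open>p\<close> is the \<open>A\<close>-orthogonal projection \<open>P i e\<close>. It exists because \<open>T\<close> maps \<open>W\<close> onto \<open>W\<close>, by
  the Neumann series for \<open>I - T\<close>.\<close>

lemma subspace_correction_energy: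
  fixes A :: "'v::{real_inner,complete_space} \<Rightarrow> 'v"
  assumes A: "spd A" "surj A"
    and W: "subspace W"
    and Q: "is_orth_proj W Q"
    and R: "nonsingular_on W R"
    and T: "\<And>v. T v = R (Q (A v))"
    and lt: "A_onorm_on A W (\<lambda>v. v - T v) < 1"
  shows "\<exists>\<delta>>0. \<forall>e. \<exists>p\<in>W. (\<forall>w\<in>W. inner (A p) w = inner (A e) w) \<and>
    (A_norm A (e - T e))\<^sup>2 \<le> (A_norm A e)\<^sup>2 - \<delta> * (A_norm A p)\<^sup>2"
proof -
  have QW: "Q v \<in> W" and Qi: "w \<in> W \<Longrightarrow> inner (Q v) w = inner v w" for v w
    using Q by (auto simp: is_orth_proj_def)
  \<comment> \<open>The defect of additivity lies in \<open>W\<close> and is orthogonal to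
    \<open>W\<close>, hence to itself.\<close>
  have Qadd: "Q (v + w) = Q v + Q w" for v w
  proof -
    define z where "z = Q (v + w) - (Q v + Q w)"
    have zW: "z \<in> W"
      unfolding z_def using W QW by (intro subspace_diff subspace_add)
    then have "inner z z = 0"
      by (subst (1) z_def) (simp add: inner_diff_left inner_add_left Qi)
    then show ?thesis
      by (simp add: z_def)
  qed
  have Radd: "v \<in> W \<Longrightarrow> w \<in> W \<Longrightarrow> R (v + w) = R v + R w" for v w
    using R by (simp add: nonsingular_on_def)
  have bij: "bij_betw R W W"
    using R by (simp add: nonsingular_on_def)
  have TW: "T v \<in> W" for v
    using bij QW by (auto simp: T bij_betw_def)
  have Tadd: "T (v + w) = T v + T w" for v w
    by (simp add: T linear_add[OF spd_linear[OF A(1)]] Qadd Radd QW)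
  have W0: "0 \<in> W"
    using W by (rule subspace_0)
  have "T 0 = 0"
    using Tadd[of 0 0] by simp
  then obtain \<rho> where \<rho>: "0 \<le> \<rho>" "\<rho> < 1"
    "\<And>v. v \<in> W \<Longrightarrow> A_norm A (v - T v) \<le> \<rho> * A_norm A v"
    using A_onorm_on_less_1D[OF A(1) W0 _ lt] by auto
  have "\<exists>p\<in>W. (\<forall>w\<in>W. inner (A p) w = inner (A e) w) \<and>
    (A_norm A (e - T e))\<^sup>2 \<le> (A_norm A e)\<^sup>2 - (1 - \<rho>\<^sup>2) * (A_norm A p)\<^sup>2" for e
  proof -
    \<comment> \<open>The Neumann series for \<open>S = I - T\<close> with right-hand side
      \<open>T e\<close>; the equation is \<open>T p = T e\<close>.\<close>
    have "\<exists>p\<in>W. p - (p - T p) = T e"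
      by (rule Neumann_solution[OF A W closed_of_orth_proj[OF W Q] _ _ \<rho>(3) \<rho>(1,2) TW])
        (auto simp: Tadd TW W subspace_diff)
    then obtain p where p: "p \<in> W" "T p = T e"
      by auto
    \<comment> \<open>Injectivity of \<open>R\<close> on \<open>W\<close> cancels \<open>R\<close>;
      what remains characterises \<open>p\<close> as the energy projection of
      \<open>e\<close>.\<close>
    then have "Q (A p) = Q (A e)"
      using bij QW by (metis T bij_betw_def inj_onD)
    then have orth: "inner (A p) w = inner (A e) w" if "w \<in> W" for w
      using Qi[OF that] by metis
    then have orth': "inner (A (e - p)) w = 0" if "w \<in> W" for w
      using that by (simp add: linear_diff[OF spd_linear[OF A(1)]] inner_diff_left)
    have "p - T p \<in> W"
      using p W TW by (simp add: subspace_diff)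
    \<comment> \<open>Pythagoras: \<open>e - T e\<close> splits into \<open>e - p\<close>, which is
      left unchanged, and \<open>p - T p\<close>, which is contracted. Comparison with the splitting
      of \<open>e\<close> gives \<open>\<delta> = 1 - \<rho>\<^sup>2\<close>.\<close>
    then have "(A_norm A (e - p + (p - T p)))\<^sup>2 = (A_norm A (e - p))\<^sup>2 + (A_norm A (p - T p))\<^sup>2"
      by (simp only: A_norm_sq_add[OF A(1)] orth')
    moreover have "(A_norm A (e - p + p))\<^sup>2 = (A_norm A (e - p))\<^sup>2 + (A_norm A p)\<^sup>2"
      using p by (subst A_norm_sq_add[OF A(1)]) (simp add: orth')
    moreover have "(A_norm A (p - T p))\<^sup>2 \<le> (\<rho> * A_norm A p)\<^sup>2"
      using \<rho>(3)[OF p(1)] by (intro power_mono A_norm_nonneg A)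
    ultimately show ?thesis
      using p orth by (intro bexI[of _ p]) (auto simp: algebra_simps power_mult_distrib)
  qed
  moreover have "1 - \<rho>\<^sup>2 > 0"
    using \<rho>(1,2) by (simp add: power_less_one_iff)
  ultimately show ?thesis
    by blast
qed

section \<open>Stable decomposition and the average correction\<close>

text \<open>Pairing \<open>e\<close> with \<open>\<Sum>i. w i\<close> gives \<open>\<Sum>i. (P i e, w i)\<^sub>A\<close>, so the vectors with
  \<open>\<Sum>i. \<parallel>P i e\<parallel>\<^sub>A \<le> 1\<close> are weakly bounded, hence bounded.\<close>

lemma stable_decomposition:
  fixes A :: "'v::{real_inner,complete_space} \<Rightarrow> 'v"
  assumes A: "spd A" "surj A"
    and sum_V: "\<forall>v. \<exists>w. (\<forall>i\<in>I. w i \<in> V i) \<and> v = (\<Sum>i\<in>I. w i)"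
    and P: "\<And>e i w. i \<in> I \<Longrightarrow> w \<in> V i \<Longrightarrow> inner (A (P i e)) w = inner (A e) w"
  shows "\<exists>c>0. \<forall>e. c * (A_norm A e)\<^sup>2 \<le> (\<Sum>i\<in>I. (A_norm A (P i e))\<^sup>2)"
proof -
  have nn: "0 \<le> A_norm A v" for v
    by (rule A_norm_nonneg[OF A(1)])
  have "\<exists>c. \<forall>e. \<bar>inner e v\<bar> \<le> c * (\<Sum>i\<in>I. A_norm A (P i e))" for v
  proof -
    obtain z where z: "v = A z"
      using A(2) by (metis surjD)
    obtain w where w: "\<forall>i\<in>I. w i \<in> V i" "z = (\<Sum>i\<in>I. w i)"
      using sum_V by blast
    \<comment> \<open>Depends on the decomposition chosen for \<open>z\<close>, hence on
      \<open>v\<close>, but not on \<open>e\<close>, as a pointwise bound requires.\<close>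
    define c where "c = (\<Sum>i\<in>I. A_norm A (w i))"
    have "\<bar>inner e v\<bar> \<le> c * (\<Sum>i\<in>I. A_norm A (P i e))" for e
    proof -
      have "inner e v = (\<Sum>i\<in>I. inner (A (P i e)) (w i))"
        using w P by (simp add: z spd_sym[OF A(1), symmetric] inner_sum_right)
      also have "\<bar>\<dots>\<bar> \<le> (\<Sum>i\<in>I. A_norm A (P i e) * A_norm A (w i))"
        by (rule order_trans[OF sum_abs sum_mono]) (rule A_norm_Cauchy_Schwarz[OF A(1)])
      also have "\<dots> \<le> (\<Sum>i\<in>I. A_norm A (P i e) * c)"
        unfolding c_def using nn
        by (cases "finite I") (auto intro!: sum_mono mult_left_mono member_le_sum)
      finally show ?thesis
        by (simp add: sum_distrib_left mult.commute)
    qed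
    then show ?thesis
      by blast
  qed
  then obtain C where C: "C \<ge> 0" "\<And>e. norm e \<le> C * (\<Sum>i\<in>I. A_norm A (P i e))"
    using norm_bound_of_pointwise_bound[of "\<lambda>e. \<Sum>i\<in>I. A_norm A (P i e)" "\<lambda>e. e"] nn
    by (auto simp: sum_nonneg)
  obtain a where a: "a > 0" "\<And>v. A_norm A v \<le> a * norm v"
    using A_norm_equiv[OF A] by blast
  \<comment> \<open>\<open>card I\<close> comes from bounding the square of a sum by the sum of
    squares; the summand 1 keeps \<open>D\<close> positive even if \<open>C\<close> or
    \<open>card I\<close> vanishes.\<close>
  define D where "D = (a * C)\<^sup>2 * real (card I) + 1"
  have D: "D > 0"
    by (simp add: D_def add_nonneg_pos)
  have "(A_norm A e)\<^sup>2 \<le> D * (\<Sum>i\<in>I. (A_norm A (P i e))\<^sup>2)" for e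
  proof -
    have "A_norm A e \<le> a * (C * (\<Sum>i\<in>I. A_norm A (P i e)))"
      using a(1) by (intro order_trans[OF a(2)] mult_left_mono C) auto
    then have "(A_norm A e)\<^sup>2 \<le> (a * C)\<^sup>2 * (\<Sum>i\<in>I. A_norm A (P i e))\<^sup>2"
      using nn by (metis power_mono power_mult_distrib mult.assoc)
    also have "\<dots> \<le> (a * C)\<^sup>2 * (real (card I) * (\<Sum>i\<in>I. (A_norm A (P i e))\<^sup>2))"
      using sum_squared_le_sum_of_squares[of "\<lambda>i. A_norm A (P i e)" I]
      by (intro mult_left_mono) (auto simp: mult.commute)
    also have "\<dots> \<le> D * (\<Sum>i\<in>I. (A_norm A (P i e))\<^sup>2)"
      by (simp add: D_def algebra_simps sum_nonneg)
    finally show ?thesis .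
  qed
  then show ?thesis
    using D by (intro exI[of _ "1 / D"]) (auto simp: field_simps)
qed

text \<open>Correction \<open>i\<close> removes at least \<open>\<delta> i\<close> times the energy
  of \<open>P i e\<close>, and by stable decomposition these energies together control that of
  \<open>e\<close>. The result is a plain sum over \<open>i\<close>; probabilities enter later as
  weights.\<close>

lemma randomized_correction_energy:
  fixes A :: "'v::{real_inner,complete_space} \<Rightarrow> 'v"
  assumes A: "spd A" "surj A"
    and I: "finite I" "I \<noteq> {}"
    and V: "\<forall>i\<in>I. subspace (V i)"
      "\<forall>v. \<exists>w. (\<forall>i\<in>I. w i \<in> V i) \<and> v = (\<Sum>i\<in>I. w i)"
    and QR: "\<forall>i\<in>I. is_orth_proj (V i) (Q i)" "\<forall>i\<in>I. nonsingular_on (V i) (R i)"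
    and lt: "\<forall>i\<in>I. A_onorm_on A (V i) (\<lambda>v. v - T_op A Q R i v) < 1"
  shows "\<exists>\<kappa>>0. \<forall>e.
    (\<forall>i\<in>I. (A_norm A (e - T_op A Q R i e))\<^sup>2 \<le> (A_norm A e)\<^sup>2) \<and>
    \<kappa> * (A_norm A e)\<^sup>2 \<le> (\<Sum>i\<in>I. (A_norm A e)\<^sup>2 - (A_norm A (e - T_op A Q R i e))\<^sup>2)"
proof -
  have "\<forall>i\<in>I. \<exists>\<delta>>0. \<forall>e. \<exists>p\<in>V i. (\<forall>w\<in>V i. inner (A p) w = inner (A e) w) \<and>
    (A_norm A (e - T_op A Q R i e))\<^sup>2 \<le> (A_norm A e)\<^sup>2 - \<delta> * (A_norm A p)\<^sup>2"
    using V QR lt by (auto intro!: subspace_correction_energy[OF A] simp: T_op_def)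
  then obtain \<delta> where \<delta>: "\<forall>i\<in>I. \<delta> i > 0 \<and> (\<forall>e. \<exists>p\<in>V i. (\<forall>w\<in>V i. inner (A p) w = inner (A e) w) \<and>
    (A_norm A (e - T_op A Q R i e))\<^sup>2 \<le> (A_norm A e)\<^sup>2 - \<delta> i * (A_norm A p)\<^sup>2)"
    by metis
  then have "\<forall>i\<in>I. \<exists>P. \<forall>e. (\<forall>w\<in>V i. inner (A (P e)) w = inner (A e) w) \<and>
    (A_norm A (e - T_op A Q R i e))\<^sup>2 \<le> (A_norm A e)\<^sup>2 - \<delta> i * (A_norm A (P e))\<^sup>2"
    by metis
  then obtain P where P: "\<And>i e w. i \<in> I \<Longrightarrow> w \<in> V i \<Longrightarrow> inner (A (P i e)) w = inner (A e) w"
    "\<And>i e. i \<in> I \<Longrightarrow>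
      (A_norm A (e - T_op A Q R i e))\<^sup>2 \<le> (A_norm A e)\<^sup>2 - \<delta> i * (A_norm A (P i e))\<^sup>2"
    by metis
  obtain c where c: "c > 0" "\<And>e. c * (A_norm A e)\<^sup>2 \<le> (\<Sum>i\<in>I. (A_norm A (P i e))\<^sup>2)"
    using stable_decomposition[OF A V(2), of P] P(1) by blast
  \<comment> \<open>A common lower bound for the decrease factors, positive because \<open>I\<close>
    is finite and nonempty.\<close>
  define m where "m = Min (\<delta> ` I)"
  have m: "m > 0" "\<And>i. i \<in> I \<Longrightarrow> m \<le> \<delta> i"
    using I \<delta> by (auto simp: m_def)
  have drop: "m * (A_norm A (P i e))\<^sup>2 \<le> (A_norm A e)\<^sup>2 - (A_norm A (e - T_op A Q R i e))\<^sup>2"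
    if "i \<in> I" for i e
    using P(2)[OF that, of e] mult_right_mono[OF m(2)[OF that], of "(A_norm A (P i e))\<^sup>2"] by simp
  have "(m * c) * (A_norm A e)\<^sup>2 \<le> (\<Sum>i\<in>I. (A_norm A e)\<^sup>2 - (A_norm A (e - T_op A Q R i e))\<^sup>2)"
    for e
  proof -
    have "m * c * (A_norm A e)\<^sup>2 \<le> m * (\<Sum>i\<in>I. (A_norm A (P i e))\<^sup>2)"
      using m c(2)[of e] by simp
    also have "\<dots> \<le> (\<Sum>i\<in>I. (A_norm A e)\<^sup>2 - (A_norm A (e - T_op A Q R i e))\<^sup>2)"
      unfolding sum_distrib_left by (intro sum_mono drop)
    finally show ?thesis .
  qed
  moreover have "(A_norm A (e - T_op A Q R i e))\<^sup>2 \<le> (A_norm A e)\<^sup>2" if "i \<in> I" for i e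
  proof -
    have "0 \<le> m * (A_norm A (P i e))\<^sup>2"
      using m by simp
    then show ?thesis
      using drop[OF that, of e] by linarith
  qed
  ultimately show ?thesis
    using m c by (intro exI[of _ "m * c"]) auto
qed

section \<open>Energy decay of randomly driven iterations\<close>

text \<open>Detaches the probabilistic argument from the Hilbert space: all randomness sits in the
  sequence of draws.\<close>

primrec random_iterate :: "('d \<Rightarrow> 's \<Rightarrow> 's) \<Rightarrow> 's \<Rightarrow> (nat \<Rightarrow> 'd) \<Rightarrow> nat \<Rightarrow> 's" where
  "random_iterate step x0 d 0 = x0"
| "random_iterate step x0 d (Suc k) = step (d k) (random_iterate step x0 d k)"

text \<open>State \<open>k\<close> reads only draws before \<open>k\<close>; its independence of
  draw \<open>k\<close> rests on this.\<close>

lemma random_iterate_cong: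
  "(\<And>j. j < k \<Longrightarrow> d j = d' j) \<Longrightarrow> random_iterate step x0 d k = random_iterate step x0 d' k"
  by (induction k) auto

text \<open>The draws have a countable type, so conditioning on each value works even for the
  discrete sigma-algebra on states. Any \<open>step\<close> and any energy are then
  measurable.\<close>

lemma measurable_random_iterate:
  fixes step :: "'d::countable \<Rightarrow> 's \<Rightarrow> 's"
  assumes "\<And>j. j < k \<Longrightarrow> (\<lambda>x. d x j) \<in> measurable N (count_space UNIV)"
  shows "(\<lambda>x. random_iterate step x0 (d x) k) \<in> measurable N (count_space UNIV)"
  using assms
proof (induction k)
  case (Suc k)
  have "(\<lambda>x. (\<lambda>a x. step a (random_iterate step x0 (d x) k)) (d x k) x)
      \<in> measurable N (count_space UNIV)"
    by (rule measurable_compose_countable, rule measurable_compose[OF Suc.IH])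
      (use Suc.prems in auto)
  then show ?case
    by simp
qed simp

text \<open>The hypothesis on \<open>\<kappa>\<close> bounds the mean decrease from a fixed state.
  Independence of draw and state carries it over to expectations, whose sum is then finite.\<close>

lemma random_iterate_energy_AE:
  fixes step :: "'d::countable \<Rightarrow> 's \<Rightarrow> 's" and E :: "'s \<Rightarrow> real"
  assumes "prob_space M"
    and indep: "prob_space.indep_vars M (\<lambda>_. count_space UNIV) D UNIV"
    and distr: "\<And>k. distr M (count_space UNIV) (D k) = measure_pmf p"
    and S: "finite S" "set_pmf p \<subseteq> S"
    and nonneg: "\<And>x. 0 \<le> E x"
    and mono: "\<And>d x. d \<in> S \<Longrightarrow> E (step d x) \<le> E x"
    and \<kappa>: "\<kappa> > 0" "\<And>x. \<kappa> * E x \<le> (\<Sum>d\<in>S. pmf p d * (E x - E (step d x)))"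
  shows "AE \<omega> in M. (\<lambda>k. E (random_iterate step x0 (\<lambda>k. D k \<omega>) k)) \<longlonglongrightarrow> 0"
proof -
  interpret prob_space M by fact
  define X where "X k \<omega> = random_iterate step x0 (\<lambda>k. D k \<omega>) k" for k \<omega>
  have D[measurable]: "D k \<in> measurable M (count_space UNIV)" for k
    using indep by (simp add: indep_vars_def2)
  have X[measurable]: "X k \<in> measurable M (count_space UNIV)" for k
    unfolding X_def by (rule measurable_random_iterate) simp
  have "AE \<omega> in M. D k \<omega> \<in> S" for k
  proof (rule AE_distrD[OF D])
    show "AE x in distr M (count_space UNIV) (D k). x \<in> S"
      unfolding distr using S by (auto simp: AE_measure_pmf_iff)
  qed
  then have DS: "AE \<omega> in M. \<forall>k. D k \<omega> \<in> S"
    by (simp add: AE_all_countable)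
  \<comment> \<open>Almost surely every draw lies in \<open>S\<close>, so the energy never exceeds
    its initial value. This makes all functions below integrable.\<close>
  have bound: "AE \<omega> in M. E (X k \<omega>) \<le> E x0" for k
    using DS
  proof eventually_elim
    case (elim \<omega>)
    show ?case
      using elim mono by (induction k) (auto simp: X_def intro: order_trans)
  qed
  have EX: "(\<lambda>\<omega>. g (X k \<omega>)) \<in> borel_measurable M" for g :: "'s \<Rightarrow> real" and k
    using X by (rule measurable_compose) simp
  have [measurable]: "(\<lambda>\<omega>. E (X k \<omega>)) \<in> borel_measurable M"
    "(\<lambda>\<omega>. E (step d (X k \<omega>))) \<in> borel_measurable M" for k d
    by (rule EX)+
  have int: "integrable M (\<lambda>\<omega>. E (X k \<omega>))" for k
    using bound[of k] nonneg by (intro integrable_const_bound[where B = "E x0"] EX) auto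
  have int_drop: "integrable M (\<lambda>\<omega>. E (X k \<omega>) - E (step d (X k \<omega>)))" if "d \<in> S" for k d
  proof (rule integrable_const_bound[where B = "E x0"])
    show "AE \<omega> in M. norm (E (X k \<omega>) - E (step d (X k \<omega>))) \<le> E x0"
      using bound[of k]
    proof eventually_elim
      case (elim \<omega>)
      then show ?case
        using mono[OF that, of "X k \<omega>"] nonneg[of "step d (X k \<omega>)"] by simp
    qed
  qed (rule EX[of "\<lambda>x. E x - E (step d x)"])
  \<comment> \<open>The indicator is a function of coordinate \<open>k\<close> and the decrease one
    of the coordinates below \<open>k\<close>: disjoint blocks of an independent family.\<close>
  have indep_drop: "indep_var borel (\<lambda>\<omega>. indicator {d} (D k \<omega>))
      borel (\<lambda>\<omega>. E (X k \<omega>) - E (step d (X k \<omega>)))" for k d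
  proof -
    let ?N = "\<lambda>K. PiM K (\<lambda>_. count_space UNIV)"
    have "indep_var borel ((\<lambda>x. indicator {d} (x k)) \<circ> (\<lambda>\<omega>. restrict (\<lambda>j. D j \<omega>) {k}))
       borel ((\<lambda>x. (\<lambda>y. E y - E (step d y)) (random_iterate step x0 x k)) \<circ>
         (\<lambda>\<omega>. restrict (\<lambda>j. D j \<omega>) {..<k}))"
    proof (rule indep_var_compose[OF indep_var_restrict[OF indep]])
      have "(\<lambda>x. random_iterate step x0 x k) \<in> measurable (?N {..<k}) (count_space UNIV)"
        by (rule measurable_random_iterate) (auto intro: measurable_component_singleton)
      then show "(\<lambda>x. (\<lambda>y. E y - E (step d y)) (random_iterate step x0 x k))
          \<in> borel_measurable (?N {..<k})"
        by (rule measurable_compose) simp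
      have "(\<lambda>x. x k) \<in> measurable (?N {k}) (count_space UNIV)"
        by (rule measurable_component_singleton) simp
      then show "(\<lambda>x. indicator {d} (x k)) \<in> borel_measurable (?N {k})"
        by (rule measurable_compose) simp
    qed auto
    moreover have "random_iterate step x0 (restrict (\<lambda>j. D j \<omega>) {..<k}) k = X k \<omega>" for \<omega>
      unfolding X_def by (rule random_iterate_cong) simp
    ultimately show ?thesis
      by (simp add: o_def)
  qed
  have int_ind: "integrable M (\<lambda>\<omega>. indicator {d} (D k \<omega>) :: real)" for k d
    by (rule integrable_const_bound[where B = 1]) (auto simp: indicator_def)
  have exp_ind: "(\<integral>\<omega>. indicator {d} (D k \<omega>) \<partial>M) = pmf p d" for k d
  proof -
    have "(\<integral>\<omega>. indicator {d} (D k \<omega>) \<partial>M) = 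
        (\<integral>x. indicat_real {d} x \<partial>distr M (count_space UNIV) (D k))"
      by (subst integral_distr) auto
    also have "\<dots> = pmf p d"
      unfolding distr by (simp add: measure_pmf_single)
    finally show ?thesis .
  qed
  define m where "m k = (\<integral>\<omega>. E (X k \<omega>) \<partial>M)" for k
  have m_nonneg: "m k \<ge> 0" for k
    unfolding m_def by (simp add: nonneg)
  have m_step: "\<kappa> * m k \<le> m k - m (Suc k)" for k
  proof -
    let ?drop = "\<lambda>d \<omega>. E (X k \<omega>) - E (step d (X k \<omega>))"
    have "\<kappa> * m k = (\<integral>\<omega>. \<kappa> * E (X k \<omega>) \<partial>M)"
      by (simp add: m_def)
    also have "\<dots> \<le> (\<integral>\<omega>. (\<Sum>d\<in>S. pmf p d * ?drop d \<omega>) \<partial>M)"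
      using int int_drop by (intro integral_mono \<kappa>(2)) auto
    also have "\<dots> = (\<Sum>d\<in>S. pmf p d * (\<integral>\<omega>. ?drop d \<omega> \<partial>M))"
      using int_drop by simp
    \<comment> \<open>\<open>pmf p d\<close> is the expectation of the indicator of draw
      \<open>d\<close>; independence merges the product of expectations into the expectation of a
      product.\<close>
    also have "\<dots> = (\<Sum>d\<in>S. (\<integral>\<omega>. indicator {d} (D k \<omega>) * ?drop d \<omega> \<partial>M))"
      by (intro sum.cong refl)
        (simp only: indep_var_lebesgue_integral[OF indep_drop int_ind int_drop] exp_ind)
    also have "\<dots> = (\<integral>\<omega>. (\<Sum>d\<in>S. indicator {d} (D k \<omega>) * ?drop d \<omega>) \<partial>M)"
      by (intro Bochner_Integration.integral_sum[symmetric]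
          indep_var_integrable[OF indep_drop int_ind int_drop])
    \<comment> \<open>Exactly one indicator is nonzero, the one of the draw actually made, so the
      sum is the decrease actually taken.\<close>
    also have "\<dots> = (\<integral>\<omega>. E (X k \<omega>) - E (X (Suc k) \<omega>) \<partial>M)"
    proof (rule integral_cong_AE)
      show "AE \<omega> in M. (\<Sum>d\<in>S. indicator {d} (D k \<omega>) * ?drop d \<omega>) = E (X k \<omega>) - E (X (Suc k) \<omega>)"
        using DS
      proof eventually_elim
        case (elim \<omega>)
        have "(\<Sum>d\<in>S. indicator {d} (D k \<omega>) * ?drop d \<omega>) =
            (\<Sum>d\<in>S. if d = D k \<omega> then ?drop d \<omega> else 0)"
          by (intro sum.cong) auto
        then show ?case
          using elim S by (simp add: X_def)
      qed
    qed measurable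
    also have "\<dots> = m k - m (Suc k)"
      using int by (simp add: m_def)
    finally show ?thesis .
  qed
  \<comment> \<open>Telescoping of \<open>m_step\<close>; \<open>m n\<close> is nonnegative, so the
    partial sums are bounded.\<close>
  have "\<kappa> * (\<Sum>k<n. m k) \<le> m 0 - m n" for n
  proof (induction n)
    case (Suc n)
    then show ?case
      using m_step[of n] by (simp add: distrib_left)
  qed simp
  then have "(\<Sum>k<n. m k) \<le> m 0 / \<kappa>" for n
    using \<kappa>(1) m_nonneg[of n] by (simp add: field_simps) (smt (verit))
  then have "summable m"
    by (intro summableI_nonneg_bounded m_nonneg)
  \<comment> \<open>Monotone convergence: the sum of the energies has finite expectation, so it is
    finite almost surely and its terms tend to 0.\<close>
  have "(\<integral>\<^sup>+\<omega>. (\<Sum>k. ennreal (E (X k \<omega>))) \<partial>M) = (\<Sum>k. \<integral>\<^sup>+\<omega>. ennreal (E (X k \<omega>)) \<partial>M)"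
    by (rule nn_integral_suminf) measurable
  also have "\<dots> = (\<Sum>k. ennreal (m k))"
    unfolding m_def by (intro suminf_cong nn_integral_eq_integral int) (simp add: nonneg)
  also have "\<dots> \<noteq> \<infinity>"
    using \<open>summable m\<close> m_nonneg by (simp add: suminf_ennreal2)
  finally have "AE \<omega> in M. (\<Sum>k. ennreal (E (X k \<omega>))) \<noteq> \<infinity>"
    by (rule nn_integral_PInf_AE[rotated]) measurable
  then show ?thesis
  proof eventually_elim
    case (elim \<omega>)
    then have "summable (\<lambda>k. E (X k \<omega>))"
      using nonneg by (intro summable_suminf_not_top) auto
    then show ?case
      unfolding X_def by (rule summable_LIMSEQ_zero)
  qed
qed

section \<open>The fault-tolerant method\<close>

definition ft_error_step ::
  "('v::real_vector \<Rightarrow> 'v) \<Rightarrow> (nat \<Rightarrow> 'v \<Rightarrow> 'v) \<Rightarrow> (nat \<Rightarrow> 'v \<Rightarrow> 'v) \<Rightarrow> bool \<times> nat \<Rightarrow> 'v \<Rightarrow> 'v" where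
  "ft_error_step A Q R = (\<lambda>(b, i) e. if b then e else e - T_op A Q R i e)"

text \<open>The residual at an iterate is \<open>A\<close> applied to its error, so a correction
  acts on the error as \<open>I - T i\<close> and \<open>f\<close> disappears from the
  recursion.\<close>

lemma ft_iterate_error:
  assumes "linear A" and "A u = f"
  shows "u - ft_iterate A Q R f u0 err idx k =
    random_iterate (ft_error_step A Q R) (u - u0) (\<lambda>k. (err k, idx k)) k"
proof (induction k)
  case (Suc k)
  have "f - A v = A (u - v)" for v
    using assms by (simp add: linear_diff)
  then have "u - ft_iterate A Q R f u0 err idx (Suc k) =
      ft_error_step A Q R (err k, idx k) (u - ft_iterate A Q R f u0 err idx k)"
    by (simp add: Let_def ft_error_step_def T_op_def)
  then show ?case
    by (simp only: Suc.IH random_iterate.simps)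
qed simp

theorem theorem6:
  fixes A :: "'v::{real_inner,complete_space} \<Rightarrow> 'v"
    and V :: "nat \<Rightarrow> 'v set"
    and Q R :: "nat \<Rightarrow> 'v \<Rightarrow> 'v"
    and J :: nat
    and f u u0 :: 'v
    and \<theta> :: real
    and M :: "'w measure"
    and err :: "nat \<Rightarrow> 'w \<Rightarrow> bool"
    and idx :: "nat \<Rightarrow> 'w \<Rightarrow> nat"
  assumes "spd A"
    and "surj A"
    and "A u = f"
    and "J \<ge> 1"
    and "\<forall>i\<in>{1..J}. subspace (V i)"
    and "\<forall>v. \<exists>w. (\<forall>i\<in>{1..J}. w i \<in> V i) \<and> v = (\<Sum>i=1..J. w i)"
    and "\<forall>i\<in>{1..J}. is_orth_proj (V i) (Q i)"
    and "\<forall>i\<in>{1..J}. nonsingular_on (V i) (R i)"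
    and "\<forall>i\<in>{1..J}. A_onorm_on A (V i) (\<lambda>v. v - T_op A Q R i v) < 1"
    and "0 \<le> \<theta>" and "\<theta> < 1"
    and "ft_sampling M \<theta> J err idx"
  shows "AE \<omega> in M. (\<lambda>k. (A_norm A (u - ft_iterate A Q R f u0 (\<lambda>k. err k \<omega>) (\<lambda>k. idx k \<omega>) k))\<^sup>2)
           \<longlonglongrightarrow> 0"
proof -
  let ?E = "\<lambda>e. (A_norm A e)\<^sup>2"
  let ?p = "pair_pmf (bernoulli_pmf \<theta>) (pmf_of_set {1..J})"
  let ?S = "UNIV \<times> {1..J}"
  have J: "{1..J} \<noteq> {}"
    using assms(4) by simp
  obtain \<kappa> where \<kappa>: "\<kappa> > 0"
    "\<And>i e. i \<in> {1..J} \<Longrightarrow> ?E (e - T_op A Q R i e) \<le> ?E e"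
    "\<And>e. \<kappa> * ?E e \<le> (\<Sum>i=1..J. ?E e - ?E (e - T_op A Q R i e))"
    using randomized_correction_energy[OF assms(1,2) _ J assms(5-9)] by auto
  \<comment> \<open>The probability of an error-free step with index \<open>i\<close>, by
    independence of fault and index.\<close>
  have pmf_False: "pmf ?p (False, i) = (1 - \<theta>) / J" if "i \<in> {1..J}" for i
    using that J assms(10,11) by (simp add: pmf_pair pmf_of_set)
  have decay: "(1 - \<theta>) / J * \<kappa> * ?E e \<le> (\<Sum>d\<in>?S. pmf ?p d * (?E e - ?E (ft_error_step A Q R d e)))"
    for e
  proof -
    have "(1 - \<theta>) / J * (\<kappa> * ?E e) \<le>
        (1 - \<theta>) / J * (\<Sum>i=1..J. ?E e - ?E (e - T_op A Q R i e))"
      using assms(11) by (intro mult_left_mono \<kappa>(3)) auto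
    also have "\<dots> = (\<Sum>i=1..J. pmf ?p (False, i) * (?E e - ?E (ft_error_step A Q R (False, i) e)))"
      unfolding sum_distrib_left by (intro sum.cong refl) (simp only: pmf_False, simp add: ft_error_step_def)
    \<comment> \<open>Faulty steps leave the error unchanged, so the pairs with first component
      \<open>True\<close> contribute 0.\<close>
    also have "\<dots> = (\<Sum>d\<in>?S. pmf ?p d * (?E e - ?E (ft_error_step A Q R d e)))"
      by (simp add: sum.cartesian_product' UNIV_bool ft_error_step_def)
    finally show ?thesis
      by (simp only: mult.assoc)
  qed
  have "AE \<omega> in M. (\<lambda>k. ?E (random_iterate (ft_error_step A Q R) (u - u0)
      (\<lambda>k. (err k \<omega>, idx k \<omega>)) k)) \<longlonglongrightarrow> 0"
  proof (rule random_iterate_energy_AE[where p = ?p and S = ?S])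
    show "set_pmf ?p \<subseteq> ?S"
      using J by (auto simp: set_pmf_of_set)
    show "?E (ft_error_step A Q R d e) \<le> ?E e" if "d \<in> ?S" for d e
      using that \<kappa>(2) by (auto simp: ft_error_step_def)
    show "(1 - \<theta>) / J * \<kappa> > 0"
      using assms(4,11) \<kappa>(1) by simp
  qed (use assms(12) decay in \<open>auto simp: ft_sampling_def\<close>)
  then show ?thesis
    by (simp add: ft_iterate_error[OF spd_linear[OF assms(1)] assms(3)])
qed

end
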